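(* Consider the orientable foliation of $\mathbb{L}^2-\{0\}$ by concentric squares, whose leaves are the sets $S_\alpha=\{(x,y)\in\mathbb{L}^2 : \max\{|x|,|y|\}=\alpha\}$, $\alpha\in\mathbb{L}_+$. There is no compatible flow, i.e. no flow on $\mathbb{L}^2-\{0\}$ whose orbits are exactly the leaves $S_\alpha$.
   Context: The closed long ray $\mathbb{L}_{\ge 0}$ is $\omega_1\times[0,1)$ with the lexicographic order topology, with least element denoted $0$; $\mathbb{L}_+=\mathbb{L}_{\ge 0}-\{0\}$ is the open long ray. The long line $\mathbb{L}$ is obtained from two copies of $\mathbb{L}_{\ge 0}$ (one with order reversed, its elements written $-x$) by identifying their points $0$; $|\cdot|\colon\mathbb{L}\to\mathbb{L}_{\ge 0}$ is the obvious absolute value, $|\pm x|=x$. $\mathbb{L}^2$ is the long plane and $0\in\mathbb{L}^2$ denotes $(0,0)$. A flow on $X$ is a continuous action $f\colon\mathbb{R}\times X\to X$ of the additive group $\mathbb{R}$; orbits are the sets $f(\mathbb{R}\times\{x\})$. *)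

theory Defs
  imports Complex_Main "HOL-Library.Countable_Set"
begin

section \<open>The ordinal \<open>\<omega>\<^sub>1\<close>\<close>

text \<open>
  \<open>cardSuc natLeq\<close> is a cardinal well-order whose cardinality is the successor of \<open>\<aleph>\<^sub>0\<close>,
  so its order type is the initial ordinal \<open>\<omega>\<^sub>1\<close>.
\<close>

typedef omega1 = "Field (cardSuc natLeq)"
proof -
  have "Field (cardSuc natLeq) \<noteq> {}"
    using infinite_UNIV_nat Field_natLeq cardSuc_finite[OF natLeq_Card_order] by auto
  then show ?thesis by auto
qed

instantiation omega1 :: wellorder
begin

definition less_eq_omega1 :: "omega1 \<Rightarrow> omega1 \<Rightarrow> bool" where
  "a \<le> b \<longleftrightarrow> (Rep_omega1 a, Rep_omega1 b) \<in> cardSuc natLeq"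

definition less_omega1 :: "omega1 \<Rightarrow> omega1 \<Rightarrow> bool" where
  "a < b \<longleftrightarrow> a \<le> b \<and> \<not> b \<le> (a :: omega1)"

instance
proof -
  let ?r = "cardSuc natLeq"
  have wo: "Well_order ?r"
    using cardSuc_Card_order[OF natLeq_Card_order] by (simp add: card_order_on_def)
  have r: "refl_on (Field ?r) ?r" and t: "trans ?r" and a: "antisym ?r"
    and tot: "total_on (Field ?r) ?r" and wf: "wf (?r - Id)"
    using wo unfolding well_order_on_def linear_order_on_def partial_order_on_def
      preorder_on_def by auto
  show "OFCLASS(omega1, wellorder_class)"
  proof (intro_classes)
    fix x y z :: omega1
    show "(x < y) = (x \<le> y \<and> \<not> y \<le> x)" by (rule less_omega1_def)
    show "x \<le> x"
      using r Rep_omega1 by (auto simp: less_eq_omega1_def refl_on_def)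
    show "x \<le> z" if "x \<le> y" "y \<le> z"
      using that t unfolding less_eq_omega1_def by (meson transD)
    show "x = y" if "x \<le> y" "y \<le> x"
      using that a unfolding less_eq_omega1_def by (meson antisymD Rep_omega1_inject)
    show "x \<le> y \<or> y \<le> x"
    proof (cases "x = y")
      case True
      then show ?thesis
        using r Rep_omega1 by (auto simp: less_eq_omega1_def refl_on_def)
    next
      case False
      then show ?thesis
        using tot Rep_omega1[of x] Rep_omega1[of y] unfolding less_eq_omega1_def total_on_def
        by (metis Rep_omega1_inject)
    qed
  next
    fix P :: "omega1 \<Rightarrow> bool" and c
    assume step: "\<And>x. (\<And>y. y < x \<Longrightarrow> P y) \<Longrightarrow> P x"
    have "wf (inv_image (?r - Id) Rep_omega1)" using wf by (rule wf_inv_image)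
    then show "P c"
    proof (induction c rule: wf_induct_rule)
      case (less x)
      show ?case
      proof (rule step)
        fix y assume "y < x"
        then have "(y, x) \<in> inv_image (?r - Id) Rep_omega1"
          unfolding less_omega1_def by (auto simp: less_eq_omega1_def)
        then show "P y" by (rule less.IH)
      qed
    qed
  qed
qed

end

lemma uncountable_omega1: "uncountable (UNIV :: omega1 set)"
proof
  assume "countable (UNIV :: omega1 set)"
  then have "countable (range Rep_omega1)" by simp
  then have c: "countable (Field (cardSuc natLeq))"
    using type_definition.Rep_range[OF type_definition_omega1] by simp
  have "(card_of (Field (cardSuc natLeq)), natLeq) \<in> ordLeq"
    using c by (metis countable_def card_of_ordLeq card_of_nat ordLeq_ordIso_trans subset_UNIV)
  moreover have "(natLeq, card_of (Field (cardSuc natLeq))) \<in> ordLess"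
    using cardSuc_greater[OF natLeq_Card_order]
      card_of_Field_ordIso[OF cardSuc_Card_order[OF natLeq_Card_order]]
    by (meson ordIso_symmetric ordLess_ordIso_trans)
  ultimately show False by (simp add: not_ordLeq_ordLess)
qed

lemma countable_initial_segment_omega1: "countable {..<(a :: omega1)}"
proof -
  let ?r = "cardSuc natLeq"
  have co: "Card_order ?r" by (rule cardSuc_Card_order[OF natLeq_Card_order])
  have "(card_of (underS ?r (Rep_omega1 a)), ?r) \<in> ordLess"
    using card_of_underS[OF co Rep_omega1] .
  then have "(card_of (underS ?r (Rep_omega1 a)), natLeq) \<in> ordLeq"
    using cardSuc_ordLess_ordLeq natLeq_Card_order by (metis cardSuc_ordLeq_ordLess card_of_Card_order)
  then have "countable (underS ?r (Rep_omega1 a))"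
    by (metis countable_def card_of_ordLeq card_of_nat ordIso_symmetric ordLeq_ordIso_trans)
  moreover have "Rep_omega1 ` {..<a} \<subseteq> underS ?r (Rep_omega1 a)"
    by (auto simp: underS_def less_omega1_def less_eq_omega1_def)
  ultimately have "countable (Rep_omega1 ` {..<a})" by (rule countable_subset[rotated])
  then show ?thesis
    by (rule countable_image_inj_on) (simp add: inj_on_def Rep_omega1_inject)
qed


section \<open>The closed long ray\<close>

typedef closed_long_ray = "(UNIV :: omega1 set) \<times> {0..<1::real}"
  by (rule exI[of _ "(undefined, 0)"]) simp

setup_lifting type_definition_closed_long_ray

instantiation closed_long_ray :: linorder
begin

lift_definition less_eq_closed_long_ray :: "closed_long_ray \<Rightarrow> closed_long_ray \<Rightarrow> bool"
  is "\<lambda>(a, s) (b, t). a < b \<or> (a = b \<and> s \<le> t)" .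

lift_definition less_closed_long_ray :: "closed_long_ray \<Rightarrow> closed_long_ray \<Rightarrow> bool"
  is "\<lambda>(a, s) (b, t). a < b \<or> (a = b \<and> s < t)" .

instance
  by intro_classes (transfer; auto)+

end

instantiation closed_long_ray :: zero
begin

lift_definition zero_closed_long_ray :: closed_long_ray is "(LEAST a. True, 0)" by simp

instance ..

end

lemma closed_long_ray_zero_le: "0 \<le> (x :: closed_long_ray)"
proof -
  have least: "(LEAST b. True) \<le> (a :: omega1)" for a by (simp add: Least_le)
  show ?thesis by transfer (use least in \<open>auto simp: le_less\<close>)
qed

instantiation closed_long_ray :: linorder_topology
begin

definition open_closed_long_ray :: "closed_long_ray set \<Rightarrow> bool" where
  "open_closed_long_ray =
     generate_topology (range (\<lambda>a. {..<a}) \<union> range (\<lambda>a. {a<..}))"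

instance
  by (intro_classes)
     (auto simp: open_closed_long_ray_def generate_topology.UNIV
       intro: generate_topology.Int generate_topology.UN)

end

definition open_long_ray :: "closed_long_ray set" where
  "open_long_ray = {x. 0 < x}"

(* otherwise the lifted definitions below would also unfold the representation of the ray *)
lifting_forget closed_long_ray.lifting


section \<open>The long line\<close>

text \<open>
  In \<open>bool \<times> closed_long_ray\<close> the flag selects one of the two copies of the closed long ray:
  \<open>False\<close> is the copy with its own order, \<open>True\<close> the reversed copy, i.e.\ the points \<open>-x\<close>.
\<close>

quotient_type long_line = "bool \<times> closed_long_ray" /
  "\<lambda>p q. p = q \<or> (snd p = 0 \<and> snd q = 0)"
  by (rule equivpI) (auto simp: reflp_def symp_def transp_def)

lift_definition long_pos :: "closed_long_ray \<Rightarrow> long_line" is "\<lambda>x. (False, x)" .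

lift_definition long_neg :: "closed_long_ray \<Rightarrow> long_line" is "\<lambda>x. (True, x)" .

lift_definition long_abs :: "long_line \<Rightarrow> closed_long_ray" is snd by auto

instantiation long_line :: zero
begin

definition zero_long_line :: long_line where "0 = long_pos 0"

instance ..

end

lemma long_neg_zero: "long_neg 0 = 0"
  unfolding zero_long_line_def by transfer simp

lemma long_line_cases: obtains x where "y = long_pos x" | x where "y = long_neg x"
  by transfer (metis (full_types) prod.collapse)

text \<open>
  The quotient topology of the disjoint union of the two copies; reversing the order of a copy
  does not change its order topology.
\<close>

instantiation long_line :: topological_space
begin

definition open_long_line :: "long_line set \<Rightarrow> bool" where
  "open_long_line U \<longleftrightarrow> open (long_pos -` U) \<and> open (long_neg -` U)"

instance
  by intro_classes (auto simp: open_long_line_def vimage_Union)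

end


section \<open>Flows and the foliation by concentric squares\<close>

definition flow_on :: "'a::topological_space set \<Rightarrow> (real \<times> 'a \<Rightarrow> 'a) \<Rightarrow> bool" where
  "flow_on X f \<longleftrightarrow>
     continuous_on (UNIV \<times> X) f \<and> f ` (UNIV \<times> X) \<subseteq> X \<and>
     (\<forall>x\<in>X. f (0, x) = x) \<and>
     (\<forall>s t. \<forall>x\<in>X. f (s + t, x) = f (s, f (t, x)))"

definition orbits :: "'a set \<Rightarrow> (real \<times> 'a \<Rightarrow> 'a) \<Rightarrow> 'a set set" where
  "orbits X f = (\<lambda>x. f ` (UNIV \<times> {x})) ` X"

definition punctured_long_plane :: "(long_line \<times> long_line) set" where
  "punctured_long_plane = UNIV - {(0, 0)}"

definition concentric_square :: "closed_long_ray \<Rightarrow> (long_line \<times> long_line) set" where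
  "concentric_square \<alpha> = {(x, y). max (long_abs x) (long_abs y) = \<alpha>}"

end

theory Submission imports Defs begin

text \<open>
  For a time \<open>q\<close> let \<open>h q y \<le> y\<close> be the absolute value of the first coordinate at time \<open>q\<close> of the
  flow line starting at \<open>(0, y)\<close>. If the continuous function \<open>h q\<close> is unbounded, then an
  interleaving argument shows that its fixed points are closed and cofinal in the long ray.
  Treating all rational \<open>q\<close> simultaneously gives \<open>d < z\<close>, with points strictly between them,
  such that each \<open>h q z\<close> with \<open>q\<close> rational is at most \<open>d\<close> or equal to \<open>z\<close>. By continuity in
  time the same dichotomy holds for all real times, so the flow line through \<open>(0, z)\<close> misses
  the points of the square whose first coordinate lies strictly between \<open>d\<close> and \<open>z\<close>.
\<close>

text \<open>Otherwise \<open>omega1\<close> would be a countable union of countable initial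
  segments.\<close>

lemma countable_strictly_bounded_omega1:
  assumes "countable (A :: omega1 set)"
  obtains b where "\<forall>a\<in>A. a < b"
proof -
  have "\<exists>b. \<forall>a\<in>A. a < b"
  proof (rule ccontr)
    assume "\<not> ?thesis"
    then have "UNIV = (\<Union>a\<in>A. insert a {..<a})"
      by (auto simp: not_less) (metis order_le_less)
    moreover have "countable (\<Union>a\<in>A. insert a {..<a})"
      using assms countable_initial_segment_omega1 by auto
    ultimately show False
      using uncountable_omega1 by simp
  qed
  then show thesis using that by blast
qed

text \<open>These left endpoints of the unit intervals are cofinal in the ray, so bounds and limits
  can be sought among ordinals alone.\<close>

definition ray_point :: "omega1 \<Rightarrow> closed_long_ray" where
  "ray_point a = Abs_closed_long_ray (a, 0)"

lemma Rep_ray_point: "Rep_closed_long_ray (ray_point a) = (a, 0)"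
  by (simp add: ray_point_def Abs_closed_long_ray_inverse)

lemma ray_point_less_iff [simp]: "ray_point a < ray_point b \<longleftrightarrow> a < b"
  by (simp add: less_closed_long_ray.rep_eq Rep_ray_point)

lemma less_ray_point_iff: "x < ray_point b \<longleftrightarrow> fst (Rep_closed_long_ray x) < b"
  using Rep_closed_long_ray[of x]
  by (auto simp: less_closed_long_ray.rep_eq Rep_ray_point split: prod.splits)

lemma countable_bounded_ray_point:
  assumes "countable (A :: closed_long_ray set)"
  obtains b where "\<And>x. x \<in> A \<Longrightarrow> x < ray_point b"
proof -
  have "countable ((fst \<circ> Rep_closed_long_ray) ` A)"
    using assms by simp
  then obtain b where "\<forall>a\<in>(fst \<circ> Rep_closed_long_ray) ` A. a < b"
    using countable_strictly_bounded_omega1 by blast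
  then show thesis
    using that by (auto simp: less_ray_point_iff)
qed

text \<open>The limit comes from the least strict upper bound \<open>c\<close>: a point below
  \<open>ray_point c\<close> has ordinal part below \<open>c\<close>, which by minimality some
  \<open>a k\<close> reaches.\<close>

lemma strict_mono_ray_point_tendsto:
  fixes a :: "nat \<Rightarrow> omega1"
  assumes "strict_mono a"
  obtains c where "\<And>k. a k < c" "(\<lambda>k. ray_point (a k)) \<longlonglongrightarrow> ray_point c"
proof -
  obtain b where "\<forall>x\<in>range a. x < b"
    using countable_strictly_bounded_omega1[OF countable_image[OF countableI_type]] .
  then have ex: "\<exists>b. \<forall>k. a k < b" by blast
  define c where "c = (LEAST b. \<forall>k. a k < b)"
  have c: "a k < c" for k
    using LeastI_ex[OF ex] unfolding c_def by blast
  have "(\<lambda>k. ray_point (a k)) \<longlonglongrightarrow> ray_point c"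
  proof (rule increasing_tendsto)
    show "\<forall>\<^sub>F k in sequentially. ray_point (a k) \<le> ray_point c"
      using c by (simp add: less_imp_le)
  next
    fix x assume "x < ray_point c"
    then have "\<not> (\<forall>k. a k < fst (Rep_closed_long_ray x))"
      unfolding less_ray_point_iff c_def by (rule not_less_Least)
    then obtain k where k: "fst (Rep_closed_long_ray x) \<le> a k"
      by (auto simp: not_less)
    \<comment> \<open>At \<open>k\<close> itself the ordinal parts may coincide, so only later
      indices are strictly above \<open>x\<close>.\<close>
    have "x < ray_point (a n)" if "n > k" for n
      using le_less_trans[OF k strict_monoD[OF assms that]] by (simp add: less_ray_point_iff)
    then show "\<forall>\<^sub>F n in sequentially. x < ray_point (a n)"
      by (rule eventually_mono[OF eventually_gt_at_top])
  qed
  then show thesis using that c by blast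
qed

text \<open>Countability of \<open>I\<close> lets one bound serve all bounded members and one
  interleaving sequence serve all unbounded ones.\<close>

lemma regressive_family_common_gap:
  fixes h :: "'i \<Rightarrow> closed_long_ray \<Rightarrow> closed_long_ray"
  assumes I: "countable I"
    and cont: "\<And>i. i \<in> I \<Longrightarrow> continuous_on {0<..} (h i)"
    and le: "\<And>i y. i \<in> I \<Longrightarrow> 0 < y \<Longrightarrow> h i y \<le> y"
  obtains d e z where "d < e" "e < z" "\<And>i. i \<in> I \<Longrightarrow> h i z \<le> d \<or> h i z = z"
proof -
  define bdd where "bdd i d \<longleftrightarrow> (\<forall>y>0. h i y \<le> d)" for i d
  define J where "J = {i \<in> I. \<nexists>d. bdd i d}"
  have "countable ((\<lambda>i. SOME d. bdd i d) ` (I - J))"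
    using I by blast
  then obtain a0 where a0: "(SOME d. bdd i d) < ray_point a0" if "i \<in> I - J" for i
    using countable_bounded_ray_point by (metis imageI)
  have bounded: "h i y \<le> ray_point a0" if i: "i \<in> I - J" and y: "0 < y" for i y
  proof -
    have "bdd i (SOME d. bdd i d)"
      using i unfolding J_def by (auto intro: someI_ex)
    then show ?thesis
      using a0[OF i] y unfolding bdd_def by (meson le_less_trans less_imp_le)
  qed
  \<comment> \<open>Each unbounded member exceeds \<open>ray_point a\<close> somewhere; one
    \<open>ray_point b\<close> lies above countably many such arguments. Inserting
    \<open>ray_point a\<close> among them forces \<open>a < b\<close>.\<close>
  have step: "\<exists>b>a. \<forall>i\<in>J. \<exists>y>0. ray_point a < h i y \<and> y < ray_point b" for a
  proof -
    have "\<forall>i\<in>J. \<exists>y>0. ray_point a < h i y"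
      unfolding J_def bdd_def by (auto simp: not_le)
    then obtain y where y: "\<And>i. i \<in> J \<Longrightarrow> 0 < y i \<and> ray_point a < h i (y i)"
      by metis
    have "countable (insert (ray_point a) (y ` J))"
      using I unfolding J_def by simp
    then obtain b where "\<And>x. x \<in> insert (ray_point a) (y ` J) \<Longrightarrow> x < ray_point b"
      using countable_bounded_ray_point by blast
    then show ?thesis using y
      by (metis imageI insertI1 insertI2 ray_point_less_iff)
  qed
  \<comment> \<open>Starting at \<open>a0\<close> puts the limit above the common bound of the
    bounded members.\<close>
  have "\<exists>a. \<forall>k. (k = 0 \<longrightarrow> a k = a0) \<and> a k < a (Suc k) \<and>
      (\<forall>i\<in>J. \<exists>y>0. ray_point (a k) < h i y \<and> y < ray_point (a (Suc k)))"
    by (rule dependent_nat_choice) (use step in blast)+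
  then obtain a where a: "a 0 = a0" "\<And>k. a k < a (Suc k)"
      "\<And>k. \<forall>i\<in>J. \<exists>y>0. ray_point (a k) < h i y \<and> y < ray_point (a (Suc k))"
    by blast
  have "strict_mono a" using a(2) by (simp add: strict_mono_Suc_iff)
  then obtain c where c: "\<And>k. a k < c" "(\<lambda>k. ray_point (a k)) \<longlonglongrightarrow> ray_point c"
    using strict_mono_ray_point_tendsto by blast
  have pos: "0 < ray_point c"
    using c(1) closed_long_ray_zero_le le_less_trans ray_point_less_iff by blast
  have "h i (ray_point c) = ray_point c" if i: "i \<in> J" for i
  proof -
    have "\<forall>k. \<exists>y>0. ray_point (a k) < h i y \<and> y < ray_point (a (Suc k))"
      using a(3) i by blast
    then obtain y where y: "\<And>k. 0 < y k" "\<And>k. ray_point (a k) < h i (y k)"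
        "\<And>k. y k < ray_point (a (Suc k))"
      by metis
    have iI: "i \<in> I" using i by (simp add: J_def)
    \<comment> \<open>Now \<open>ray_point (a k) < h i (y k) \<le> y k < ray_point (a (Suc
      k))\<close>: arguments and values are squeezed to the same limit, which by continuity is a
      fixed point.\<close>
    have "h i (y k) \<le> y k" for k using le iI y(1) .
    then have bds: "ray_point (a k) \<le> y k" "y k \<le> ray_point (a (Suc k))"
        "ray_point (a k) \<le> h i (y k)" "h i (y k) \<le> ray_point (a (Suc k))" for k
      using y(2,3)[of k] by (meson less_imp_le order_trans)+
    have lims: "(\<lambda>k. ray_point (a (Suc k))) \<longlonglongrightarrow> ray_point c"
      using c(2) by (rule LIMSEQ_Suc)
    have "y \<longlonglongrightarrow> ray_point c"
      by (rule tendsto_sandwich[OF _ _ c(2) lims])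
         (use bds in \<open>auto intro: always_eventually\<close>)
    then have "(\<lambda>k. h i (y k)) \<longlonglongrightarrow> h i (ray_point c)"
      by (rule continuous_on_tendsto_compose[OF cont[OF iI]]) (use pos y(1) in auto)
    moreover have "(\<lambda>k. h i (y k)) \<longlonglongrightarrow> ray_point c"
      by (rule tendsto_sandwich[OF _ _ c(2) lims])
         (use bds in \<open>auto intro: always_eventually\<close>)
    ultimately show ?thesis by (rule LIMSEQ_unique)
  qed
  then have "h i (ray_point c) \<le> ray_point a0 \<or> h i (ray_point c) = ray_point c" if "i \<in> I" for i
    using bounded pos that by blast
  \<comment> \<open>This is the witness \<open>e\<close> between \<open>d = ray_point a0\<close> and
    \<open>z = ray_point c\<close>; index 0 would only give back \<open>d\<close>.\<close>
  moreover have "ray_point a0 < ray_point (a (Suc 0))" using a by (metis ray_point_less_iff)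
  moreover have "ray_point (a (Suc 0)) < ray_point c" using c(1) by simp
  ultimately show thesis using that by blast
qed

lemma continuous_on_long_pos: "continuous_on A long_pos"
  by (rule continuous_on_subset[of UNIV])
     (auto simp: continuous_on_open_vimage open_long_line_def)

lemma long_abs_long_pos [simp]: "long_abs (long_pos x) = x"
  by transfer simp

lemma long_abs_long_neg [simp]: "long_abs (long_neg x) = x"
  by transfer simp

lemma long_abs_zero [simp]: "long_abs 0 = 0"
  by (simp add: zero_long_line_def)

lemma continuous_on_long_abs: "continuous_on A long_abs"
  by (rule continuous_on_subset[of UNIV])
     (auto simp: continuous_on_open_vimage open_long_line_def vimage_def)

text \<open>The orbit is some square, and it contains \<open>p\<close> at time 0; distinct squares
  are disjoint, so it is the square of \<open>p\<close>.\<close>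

lemma orbit_eq_concentric_square:
  assumes flow: "flow_on punctured_long_plane f"
    and orb: "orbits punctured_long_plane f = concentric_square ` open_long_ray"
    and p: "p \<in> concentric_square \<alpha>" "p \<in> punctured_long_plane"
  shows "f ` (UNIV \<times> {p}) = concentric_square \<alpha>"
proof -
  have "f ` (UNIV \<times> {p}) \<in> concentric_square ` open_long_ray"
    using p(2) unfolding orb[symmetric] orbits_def by blast
  then obtain \<beta> where \<beta>: "f ` (UNIV \<times> {p}) = concentric_square \<beta>" by blast
  have "f (0, p) = p" using flow p(2) by (simp add: flow_on_def)
  then have "p \<in> f ` (UNIV \<times> {p})" by (metis SigmaI UNIV_I imageI singletonI)
  then show ?thesis using \<beta> p(1) by (auto simp: concentric_square_def)
qed

theorem proposition2p6:
  "\<not> (\<exists>f. flow_on punctured_long_plane f \<and>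
        orbits punctured_long_plane f = concentric_square ` open_long_ray)"
proof
  assume "\<exists>f. flow_on punctured_long_plane f \<and>
        orbits punctured_long_plane f = concentric_square ` open_long_ray"
  then obtain f where flow: "flow_on punctured_long_plane f"
    and orb: "orbits punctured_long_plane f = concentric_square ` open_long_ray" by blast
  have contf: "continuous_on (UNIV \<times> punctured_long_plane) f"
    using flow by (simp add: flow_on_def)
  \<comment> \<open>For positive \<open>y\<close> this is a continuous transversal meeting each
    square once.\<close>
  define P where "P y = (0 :: long_line, long_pos y)" for y
  define h where "h t y = long_abs (fst (f (t, P y)))" for t y
  have P: "P y \<in> punctured_long_plane" if "0 < y" for y
    using that unfolding P_def punctured_long_plane_def
    by (auto dest: arg_cong[of _ _ long_abs])
  have orbit: "f ` (UNIV \<times> {P y}) = concentric_square y" if "0 < y" for y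
    by (rule orbit_eq_concentric_square[OF flow orb _ P[OF that]])
       (use that in \<open>simp add: P_def concentric_square_def\<close>)
  have h_le: "h t y \<le> y" if "0 < y" for t y
  proof -
    have "f (t, P y) \<in> concentric_square y" using orbit[OF that] by blast
    then show ?thesis by (auto simp: h_def concentric_square_def)
  qed
  have cont_space: "continuous_on {0<..} (h t)" for t
    unfolding h_def P_def
    by (intro continuous_on_compose2[OF continuous_on_long_abs _ subset_UNIV] continuous_on_fst
        continuous_on_compose2[OF contf] continuous_on_Pair continuous_on_const
        continuous_on_long_pos) (use P in \<open>auto simp: P_def\<close>)
  have cont_time: "continuous_on UNIV (\<lambda>t. h t y)" if "0 < y" for y
    unfolding h_def
    by (intro continuous_on_compose2[OF continuous_on_long_abs _ subset_UNIV] continuous_on_fst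
        continuous_on_compose2[OF contf] continuous_on_Pair continuous_on_const
        continuous_on_id) (use P that in auto)
  obtain d e z where dez: "d < e" "e < z" "\<And>q. q \<in> \<rat> \<Longrightarrow> h q z \<le> d \<or> h q z = z"
    using regressive_family_common_gap[OF countable_rat, of h] cont_space h_le by blast
  have z: "0 < z" using dez closed_long_ray_zero_le by (meson le_less_trans)
  \<comment> \<open>The orbit fills the whole square, so it also visits a point whose first
    coordinate lies inside the gap.\<close>
  have "(long_pos e, long_pos z) \<in> f ` (UNIV \<times> {P z})"
    using dez(2) unfolding orbit[OF z] by (simp add: concentric_square_def max_absorb2)
  then obtain t where "(long_pos e, long_pos z) = f (t, P z)" by blast
  then have t: "h t z = e" unfolding h_def by (metis fst_conv long_abs_long_pos)
  \<comment> \<open>The gap is open, so a rational time close to \<open>t\<close> lands in it as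
    well, against the choice of \<open>z\<close>.\<close>
  have "open ((\<lambda>t. h t z) -` {d<..<z})"
    using cont_time[OF z] by (simp add: continuous_on_open_vimage)
  moreover have "t \<in> (\<lambda>t. h t z) -` {d<..<z}" using t dez by simp
  ultimately obtain \<epsilon> where \<epsilon>: "0 < \<epsilon>" "\<And>s. dist s t < \<epsilon> \<Longrightarrow> h s z \<in> {d<..<z}"
    unfolding open_dist by blast
  obtain q where q: "q \<in> \<rat>" "t < q" "q < t + \<epsilon>"
    using Rats_dense_in_real[of t "t + \<epsilon>"] \<epsilon>(1) by auto
  then have "h q z \<in> {d<..<z}" using \<epsilon>(2) by (simp add: dist_real_def)
  then show False using dez(3)[OF q(1)] by auto
qed

end
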